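(* Let $n$ be a positive integer and $r$ a nonnegative integer with $n\ge r$. Then the $n$th power of the matrix $A_r$ is the $(r+2)\times(r+2)$ matrix with the following entries: (i) for $1\le i\le r$ and $1\le j\le r$: $(A_r^n)_{i,j}=\binom{n}{j-i}$ if $i\le j$, and $(A_r^n)_{i,j}=0$ if $i>j$; (ii) for $1\le i\le r$: $(A_r^n)_{i,r+1}=F_{n-r+i}^{(r-i+1)}$ and $(A_r^n)_{i,r+2}=F_{n-r+i-1}^{(r-i+1)}$; (iii) $(A_r^n)_{r+1,j}=(A_r^n)_{r+2,j}=0$ for $1\le j\le r$; (iv) $(A_r^n)_{r+1,r+1}=F_{n+1}$, $(A_r^n)_{r+1,r+2}=(A_r^n)_{r+2,r+1}=F_n$, and $(A_r^n)_{r+2,r+2}=F_{n-1}$.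
   Context: $F_n$ denotes the Fibonacci numbers, $F_0=0$, $F_1=1$, $F_{n}=F_{n-1}+F_{n-2}$ for $n\ge 2$. The Hyperfibonacci numbers $F_n^{(r)}$ of the $r$th generation ($n,r\ge 0$ integers) are defined by $F_n^{(0)}=F_n$ for $n\ge 0$ and $F_n^{(r)}=\sum_{k=0}^{n}F_k^{(r-1)}$ for $r>0$, $n\ge 0$ (so $F_0^{(r)}=0$ and $F_1^{(r)}=1$ for all $r\ge 0$). For a nonnegative integer $r$, $A_r$ is the $(r+2)\times(r+2)$ matrix with $(A_r)_{i,i}=(A_r)_{i,i+1}=1$ for $1\le i\le r+1$, $(A_r)_{r+2,r+1}=1$, and all other entries $0$. *)

theory Defs
  imports "HOL-Number_Theory.Fib" "Jordan_Normal_Form.Matrix"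
begin

fun hyperfib :: "nat \<Rightarrow> nat \<Rightarrow> nat" where
  "hyperfib 0 n = fib n"
| "hyperfib (Suc r) n = (\<Sum>k = 0..n. hyperfib r k)"

(* Matrix indices of the library start at 0, so row r + 1 is the last of the r + 2 rows. *)
definition hyperfib_mat :: "nat \<Rightarrow> int mat" where
  "hyperfib_mat r = mat (r + 2) (r + 2) (\<lambda>(i, j).
     if i \<le> r \<and> (j = i \<or> j = i + 1) \<or> i = r + 1 \<and> j = r then 1 else 0)"

(* Entry in row i and column j, both counted from 1. *)
definition entry :: "'a mat \<Rightarrow> nat \<Rightarrow> nat \<Rightarrow> 'a" where
  "entry A i j = A $$ (i - 1, j - 1)"

end

theory Submission
  imports Defs
begin

text \<open>
  Multiplying by the matrix on the left replaces each of the rows \<open>1, \<dots>, r + 1\<close> by its sum with the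
  next row, and the last row by the row above it. In each column of the claimed power this is the
  recurrence of the entries: Pascal's rule in the first \<open>r\<close> columns, and in the last two the
  identity \<open>hyperfib (d + 1) (m + 1) = hyperfib (d + 1) m + hyperfib d (m + 1)\<close>.
\<close>

lemma hyperfib_0_right [simp]: "hyperfib d 0 = 0"
  by (induction d) auto

lemma hyperfib_Suc_Suc:
  "hyperfib (Suc d) (Suc m) = hyperfib (Suc d) m + hyperfib d (Suc m)"
  by simp

declare hyperfib.simps(2) [simp del]

text \<open>For \<open>d \<le> n\<close> this is the recurrence at \<open>m = n - d\<close>; for
  \<open>d > n\<close> all three truncated indices are 0 and both sides vanish.\<close>

lemma hyperfib_Suc_diff:
  "hyperfib (Suc d) (Suc n - d) = hyperfib (Suc d) (n - d) + hyperfib d (Suc n - d)"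
  by (cases "d \<le> n") (simp_all add: Suc_diff_le hyperfib_Suc_Suc)

lemma hyperfib_mat_carrier [simp]: "hyperfib_mat r \<in> carrier_mat (r + 2) (r + 2)"
  by (simp add: hyperfib_mat_def)

lemma index_hyperfib_mat_mult:
  assumes "M \<in> carrier_mat (r + 2) c" "i < r + 2" "j < c"
  shows "(hyperfib_mat r * M) $$ (i, j) =
    (if i \<le> r then M $$ (i, j) + M $$ (Suc i, j) else M $$ (r, j))"
proof -
  have "(hyperfib_mat r * M) $$ (i, j) =
      (\<Sum>k = 0..<r + 2. (if i \<le> r \<and> (k = i \<or> k = i + 1) \<or> i = r + 1 \<and> k = r then 1 else 0)
        * M $$ (k, j))"
    using assms by (auto simp: hyperfib_mat_def scalar_prod_def intro!: sum.cong)
  \<comment> \<open>Only the columns in which row \<open>i\<close> of the matrix has a 1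
    contribute.\<close>
  also have "\<dots> = (\<Sum>k \<in> (if i \<le> r then {i, Suc i} else {r}). M $$ (k, j))"
    using assms by (intro sum.mono_neutral_cong_right) (auto split: if_splits)
  finally show ?thesis by simp
qed

text \<open>\<open>pow_mat\<close> puts the new factor on the right, but the recurrence on rows
  needs it on the left.\<close>

lemma pow_mat_Suc_left:
  assumes "A \<in> carrier_mat m m"
  shows "A ^\<^sub>m Suc n = A * A ^\<^sub>m n"
proof (induction n)
  case 0
  then show ?case using assms by simp
next
  case (Suc n)
  have "A ^\<^sub>m Suc (Suc n) = A * A ^\<^sub>m n * A" using Suc.IH by simp
  also have "\<dots> = A * (A ^\<^sub>m n * A)"
    using assms by (intro assoc_mult_mat) auto
  finally show ?case by simp
qed

text \<open>
  Indices start at 0. Truncated subtraction gives the right value 0 when \<open>n\<close> is small, so the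
  induction can start at \<open>n = 0\<close>. The lower right entry is a difference
  because \<open>fib (n - 1)\<close> would be 0 instead of 1 at \<open>n = 0\<close>.
\<close>

definition hyperfib_pow_entry :: "nat \<Rightarrow> nat \<Rightarrow> nat \<Rightarrow> nat \<Rightarrow> int" where
  "hyperfib_pow_entry r n i j =
    (if j < r then (if i \<le> j then int (n choose (j - i)) else 0)
     else if j = r then (if i \<le> r then int (hyperfib (r - i) (Suc n - (r - i))) else int (fib n))
     else (if i \<le> r then int (hyperfib (r - i) (n - (r - i)))
       else int (fib (Suc n)) - int (fib n)))"

lemma hyperfib_pow_entry_0:
  assumes "i < r + 2" "j < r + 2"
  shows "hyperfib_pow_entry r 0 i j = (if i = j then 1 else 0)"
  using assms by (auto simp: hyperfib_pow_entry_def)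

lemma hyperfib_pow_entry_Suc:
  assumes "i < r + 2" "j < r + 2"
  shows "hyperfib_pow_entry r (Suc n) i j =
    (if i \<le> r then hyperfib_pow_entry r n i j + hyperfib_pow_entry r n (Suc i) j
     else hyperfib_pow_entry r n r j)"
proof (cases "i < r")
  case True
  \<comment> \<open>In the last two columns, row \<open>i\<close> carries generation
    \<open>Suc d\<close> and row \<open>Suc i\<close> generation \<open>d\<close>.\<close>
  then obtain d where d: "r = i + Suc d"
    using less_iff_Suc_add by auto
  show ?thesis
  proof (cases "j < r")
    case True
    \<comment> \<open>Pascal's rule applies above the diagonal, where \<open>j - i\<close> is a
      successor; on it 1 = 1 + 0, and below it all terms are 0.\<close>
    then show ?thesis
      using d by (cases "i < j")
        (auto simp: hyperfib_pow_entry_def Suc_diff_le binomial_Suc_Suc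
              dest!: less_imp_Suc_add)
  next
    case False
    \<comment> \<open>The instance at \<open>n\<close> serves column \<open>r\<close>, the one at
      \<open>n - 1\<close> column \<open>r + 1\<close>; for \<open>n = 0\<close> all terms of the
      latter column are 0.\<close>
    then show ?thesis
      using d assms hyperfib_Suc_diff[of d "n"] hyperfib_Suc_diff[of d "n - 1"]
      by (cases n) (auto simp: hyperfib_pow_entry_def)
  qed
next
  case False
  \<comment> \<open>In rows \<open>r\<close> and \<open>r + 1\<close>, the last two columns reduce
    to the Fibonacci recurrence.\<close>
  then show ?thesis
    using assms by (auto simp: hyperfib_pow_entry_def)
qed

lemma index_hyperfib_mat_pow:
  assumes "i < r + 2" "j < r + 2"
  shows "(hyperfib_mat r ^\<^sub>m n) $$ (i, j) = hyperfib_pow_entry r n i j"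
  using assms
\<comment> \<open>Row \<open>i\<close> of the next power draws on other rows: \<open>Suc i\<close>,
  or \<open>r\<close> when \<open>i = r + 1\<close>.\<close>
proof (induction n arbitrary: i)
  case 0
  then show ?case
    by (simp add: hyperfib_pow_entry_0 hyperfib_mat_def)
next
  case (Suc n)
  have "hyperfib_mat r ^\<^sub>m n \<in> carrier_mat (r + 2) (r + 2)"
    by (intro pow_carrier_mat hyperfib_mat_carrier)
  with Suc show ?case
    by (simp add: pow_mat_Suc_left[OF hyperfib_mat_carrier] index_hyperfib_mat_mult
        hyperfib_pow_entry_Suc del: pow_mat.simps)
qed

theorem proposition2:
  fixes n r :: nat
  assumes "n > 0" and "n \<ge> r"
  shows "hyperfib_mat r ^\<^sub>m n \<in> carrier_mat (r + 2) (r + 2)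
    \<and> (\<forall>i\<in>{1..r}. \<forall>j\<in>{1..r}.
         entry (hyperfib_mat r ^\<^sub>m n) i j = (if i \<le> j then int (n choose (j - i)) else 0))
    \<and> (\<forall>i\<in>{1..r}.
         entry (hyperfib_mat r ^\<^sub>m n) i (r + 1) = int (hyperfib (r - i + 1) (n - r + i))
       \<and> entry (hyperfib_mat r ^\<^sub>m n) i (r + 2) = int (hyperfib (r - i + 1) (n - r + i - 1)))
    \<and> (\<forall>j\<in>{1..r}.
         entry (hyperfib_mat r ^\<^sub>m n) (r + 1) j = 0
       \<and> entry (hyperfib_mat r ^\<^sub>m n) (r + 2) j = 0)
    \<and> entry (hyperfib_mat r ^\<^sub>m n) (r + 1) (r + 1) = int (fib (n + 1))
    \<and> entry (hyperfib_mat r ^\<^sub>m n) (r + 1) (r + 2) = int (fib n)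
    \<and> entry (hyperfib_mat r ^\<^sub>m n) (r + 2) (r + 1) = int (fib n)
    \<and> entry (hyperfib_mat r ^\<^sub>m n) (r + 2) (r + 2) = int (fib (n - 1))"
proof -
  let ?A = "hyperfib_mat r ^\<^sub>m n"
  have entry: "entry ?A i j = hyperfib_pow_entry r n (i - 1) (j - 1)"
    if "i \<in> {1..r + 2}" "j \<in> {1..r + 2}" for i j
    using that by (auto simp: entry_def intro!: index_hyperfib_mat_pow)
  have "?A \<in> carrier_mat (r + 2) (r + 2)"
    by (intro pow_carrier_mat hyperfib_mat_carrier)
  moreover have "entry ?A i j = (if i \<le> j then int (n choose (j - i)) else 0)"
    if "i \<in> {1..r}" "j \<in> {1..r}" for i j
    using that by (auto simp: entry hyperfib_pow_entry_def)
  moreover have "entry ?A i (r + 1) = int (hyperfib (r - i + 1) (n - r + i))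
      \<and> entry ?A i (r + 2) = int (hyperfib (r - i + 1) (n - r + i - 1))" if "i \<in> {1..r}" for i
  proof -
    have "entry ?A i (r + 1) = int (hyperfib (r - (i - 1)) (Suc n - (r - (i - 1))))"
      "entry ?A i (r + 2) = int (hyperfib (r - (i - 1)) (n - (r - (i - 1))))"
      using that by (auto simp: entry hyperfib_pow_entry_def)
    \<comment> \<open>With \<open>1 \<le> i \<le> r \<le> n\<close>, none of these differences is
      truncated.\<close>
    moreover have "r - (i - 1) = r - i + 1" "Suc n - (r - i + 1) = n - r + i"
      "n - (r - i + 1) = n - r + i - 1"
      using that \<open>n \<ge> r\<close> by auto
    ultimately show ?thesis
      by (simp only:)
  qed
  moreover have "entry ?A (r + 1) j = 0 \<and> entry ?A (r + 2) j = 0" if "j \<in> {1..r}" for j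
    using that by (auto simp: entry hyperfib_pow_entry_def)
  moreover have "entry ?A (r + 1) (r + 1) = int (fib (n + 1))" "entry ?A (r + 1) (r + 2) = int (fib n)"
    "entry ?A (r + 2) (r + 1) = int (fib n)"
    by (simp_all add: entry hyperfib_pow_entry_def)
  moreover have "entry ?A (r + 2) (r + 2) = int (fib (n - 1))"
  proof -
    have "int (fib (Suc n)) - int (fib n) = int (fib (n - 1))"
      using \<open>n > 0\<close> by (cases n) simp_all
    then show ?thesis
      by (simp add: entry hyperfib_pow_entry_def)
  qed
  ultimately show ?thesis by blast
qed

end
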